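(* Let $\mathbf P=(P,\leq,{}',0,1)$ be an orthomodular poset of finite height and put $x\rightarrow y:=y\vee\operatorname{Max}L(x',y')$ for all $x,y\in P$. Then $\mathbb I(\mathbf P):=(P,\rightarrow,0)$ is an implication orthomodular poset of finite height.
   Context: Orthomodular poset: $(P,\leq,{}',0,1)$ with $(P,\leq,0,1)$ a bounded poset, $'$ an antitone involution ($x\leq y\Rightarrow y'\leq x'$, $x''=x$), such that writing $x\perp y$ for $x\leq y'$, the supremum $x\vee y$ exists whenever $x\perp y$, $x\vee x'=1$, $x\wedge x'=0$, and $x\leq y$ implies $(y'\vee x)'\vee x=y$. Finite height: every chain is finite. $L(a,b)$ is the set of common lower bounds of $a,b$, $\operatorname{Max}A$ the set of maximal elements of $A$, and $a\vee A=\{a\vee t\mid t\in A\}$; so $x\rightarrow y$ is a nonempty subset of $P$. An implication orthomodular poset is a triple $(I,\rightarrow,0)$ with $0\in I$ and $\rightarrow$ a mapping from $I^2$ to nonempty subsets of $I$, with abbreviations $x':=x\rightarrow0$, $1:=0'$; singletons are identified with their elements, subsets occurring as arguments of $\rightarrow$ are treated elementwise, and for subsets $A,B$ the equation $A\rightarrow B=1$ means (convention (G)) that for every $a\in A$ there is $b\in B$ with $a\rightarrow b=1$; and for all $x,y,z\in I$: (O1) $0\rightarrow x=x\rightarrow x=1$; (O2) $x\rightarrow y=y\rightarrow x=1$ implies $x=y$; (O3) $x\rightarrow y=y\rightarrow z=1$ implies $x\rightarrow z=1$; (O4) $x''=x$; (O5) $x\rightarrow y=1$ implies $(y\rightarrow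 z)\rightarrow(x\rightarrow z)=1$; (O6) $x\rightarrow y=1$ implies $(((y'\rightarrow x)\rightarrow x)'\rightarrow x)\rightarrow x=y$; (O7) $x\rightarrow y'=1$ implies $x\rightarrow((x\rightarrow y)\rightarrow y)=y\rightarrow((x\rightarrow y)\rightarrow y)=1$; (O8) $x\rightarrow y'=x\rightarrow z=y\rightarrow z=1$ implies $((x\rightarrow y)\rightarrow y)\rightarrow z=1$; (O9) $(x'\rightarrow x)\rightarrow x=1$; (O10) $x\rightarrow(y\rightarrow x)=1$. An implication orthomodular poset is of finite height if there is no infinite sequence $a_1,a_2,\ldots$ of pairwise different elements with $a_n\rightarrow a_{n+1}=1$ for all $n\geq1$. *)

theory Defs
  imports "HOL-Algebra.Lattice"
begin

section \<open>Orthomodular posets\<close>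

text \<open>
  The bounded poset is a partial order of HOL-Algebra; its bounds \<open>0\<close> and \<open>1\<close> are \<open>\<bottom>\<close> and \<open>\<top>\<close>.
  The operations \<open>\<squnion>\<close> and \<open>\<sqinter>\<close> are defined by choice and are arbitrary where the bound does not
  exist. All joins below are joins of orthogonal elements, hence exist by
  \<open>orthogonal_join_exists\<close>; the meet of \<open>x\<close> and \<open>x'\<close> exists because \<open>'\<close> turns the
  join of \<open>x'\<close> and \<open>x\<close> into it.
\<close>

locale orthomodular_poset =
  partial_order P + weak_partial_order_bottom P + weak_partial_order_top P
  for P (structure) +
  fixes neg :: "'a \<Rightarrow> 'a"
  assumes neg_closed: "x \<in> carrier P \<Longrightarrow> neg x \<in> carrier P"
    and neg_antitone: "\<lbrakk>x \<in> carrier P; y \<in> carrier P; x \<sqsubseteq> y\<rbrakk> \<Longrightarrow> neg y \<sqsubseteq> neg x"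
    and neg_involution: "x \<in> carrier P \<Longrightarrow> neg (neg x) = x"
    and orthogonal_join_exists:
      "\<lbrakk>x \<in> carrier P; y \<in> carrier P; x \<sqsubseteq> neg y\<rbrakk> \<Longrightarrow> \<exists>s. least P s (Upper P {x, y})"
    and join_neg: "x \<in> carrier P \<Longrightarrow> x \<squnion> neg x = \<top>"
    and meet_neg: "x \<in> carrier P \<Longrightarrow> x \<sqinter> neg x = \<bottom>"
    and orthomodular:
      "\<lbrakk>x \<in> carrier P; y \<in> carrier P; x \<sqsubseteq> y\<rbrakk> \<Longrightarrow> neg (neg y \<squnion> x) \<squnion> x = y"

locale finite_height_orthomodular_poset = orthomodular_poset +
  assumes finite_chains:
    "\<lbrakk>C \<subseteq> carrier P; Complete_Partial_Order.chain (\<sqsubseteq>) C\<rbrakk> \<Longrightarrow> finite C"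

definition maximal_elements :: "('a, 'b) gorder_scheme \<Rightarrow> 'a set \<Rightarrow> 'a set" where
  "maximal_elements P A = {m \<in> A. \<forall>a\<in>A. m \<sqsubseteq>\<^bsub>P\<^esub> a \<longrightarrow> a = m}"

text \<open>
  \<open>x \<rightarrow> y = y \<or> Max L(x', y')\<close>. Every \<open>t \<in> L(x', y')\<close> is below \<open>y'\<close>, so the joins exist.
\<close>

definition orthomodular_imp ::
    "('a, 'b) gorder_scheme \<Rightarrow> ('a \<Rightarrow> 'a) \<Rightarrow> 'a \<Rightarrow> 'a \<Rightarrow> 'a set" where
  "orthomodular_imp P neg x y =
     (\<lambda>t. y \<squnion>\<^bsub>P\<^esub> t) ` maximal_elements P (Lower P {neg x, neg y})"


section \<open>Implication orthomodular posets\<close>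

text \<open>
  The identification of singletons with their elements is made explicit: \<open>\<leadsto>\<close> takes two elements
  to a set, \<open>\<Leadsto>\<close> is its elementwise extension to sets, and an element \<open>x\<close> used next to a set
  is written \<open>{x}\<close>. So \<open>x'\<close> is \<open>ortho {x}\<close> and \<open>1 = 0'\<close> is the set \<open>one\<close>; (O4) forces
  both to be singletons.
\<close>

locale implication_structure =
  fixes I :: "'a set"
    and imp :: "'a \<Rightarrow> 'a \<Rightarrow> 'a set" (infix \<open>\<leadsto>\<close> 65)
    and zero :: 'a
begin

definition set_imp :: "'a set \<Rightarrow> 'a set \<Rightarrow> 'a set" (infix \<open>\<Leadsto>\<close> 65) where
  "A \<Leadsto> B = (\<Union>a\<in>A. \<Union>b\<in>B. a \<leadsto> b)"

definition ortho :: "'a set \<Rightarrow> 'a set" where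
  "ortho A = A \<Leadsto> {zero}"

definition one :: "'a set" where
  "one = ortho {zero}"

text \<open>
  Convention (G): the meaning of the equation \<open>A \<rightarrow> B = 1\<close> for sets \<open>A\<close> and \<open>B\<close>. For \<open>A = {x}\<close>
  and \<open>B = {y}\<close> it is the plain equation \<open>x \<leadsto> y = one\<close>.
\<close>

definition imp_is_one :: "'a set \<Rightarrow> 'a set \<Rightarrow> bool" where
  "imp_is_one A B \<longleftrightarrow> (\<forall>a\<in>A. \<exists>b\<in>B. a \<leadsto> b = one)"

end

locale implication_orthomodular_poset = implication_structure +
  assumes zero_closed: "zero \<in> I"
    and imp_closed: "\<lbrakk>x \<in> I; y \<in> I\<rbrakk> \<Longrightarrow> x \<leadsto> y \<subseteq> I"
    and imp_nonempty: "\<lbrakk>x \<in> I; y \<in> I\<rbrakk> \<Longrightarrow> x \<leadsto> y \<noteq> {}"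
    and O1: "x \<in> I \<Longrightarrow> zero \<leadsto> x = one \<and> x \<leadsto> x = one"
    and O2: "\<lbrakk>x \<in> I; y \<in> I; x \<leadsto> y = one; y \<leadsto> x = one\<rbrakk> \<Longrightarrow> x = y"
    and O3: "\<lbrakk>x \<in> I; y \<in> I; z \<in> I; x \<leadsto> y = one; y \<leadsto> z = one\<rbrakk> \<Longrightarrow> x \<leadsto> z = one"
    and O4: "x \<in> I \<Longrightarrow> ortho (ortho {x}) = {x}"
    and O5: "\<lbrakk>x \<in> I; y \<in> I; z \<in> I; x \<leadsto> y = one\<rbrakk> \<Longrightarrow> imp_is_one (y \<leadsto> z) (x \<leadsto> z)"
    and O6: "\<lbrakk>x \<in> I; y \<in> I; x \<leadsto> y = one\<rbrakk> \<Longrightarrow>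
      (ortho ((ortho {y} \<Leadsto> {x}) \<Leadsto> {x}) \<Leadsto> {x}) \<Leadsto> {x} = {y}"
    and O7: "\<lbrakk>x \<in> I; y \<in> I; imp_is_one {x} (ortho {y})\<rbrakk> \<Longrightarrow>
      imp_is_one {x} ((x \<leadsto> y) \<Leadsto> {y}) \<and> imp_is_one {y} ((x \<leadsto> y) \<Leadsto> {y})"
    and O8: "\<lbrakk>x \<in> I; y \<in> I; z \<in> I;
      imp_is_one {x} (ortho {y}); x \<leadsto> z = one; y \<leadsto> z = one\<rbrakk> \<Longrightarrow>
      imp_is_one ((x \<leadsto> y) \<Leadsto> {y}) {z}"
    and O9: "x \<in> I \<Longrightarrow> imp_is_one (ortho {x} \<Leadsto> {x}) {x}"
    and O10: "\<lbrakk>x \<in> I; y \<in> I\<rbrakk> \<Longrightarrow> imp_is_one {x} (y \<leadsto> x)"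

text \<open>Sequences are indexed from \<open>0\<close> rather than from \<open>1\<close>.\<close>

locale finite_height_implication_orthomodular_poset = implication_orthomodular_poset +
  assumes no_infinite_ascent:
    "\<nexists>a :: nat \<Rightarrow> 'a. range a \<subseteq> I \<and> inj a \<and> (\<forall>n. a n \<leadsto> a (Suc n) = one)"

end

(*
  Everything rests on x -> y = 1 iff x <= y: a maximal t in L(x',y') with y v t = 1 must be y' by
  orthomodularity, so y' <= x'. Hence convention (G) compares sets by the order. Two further values
  of the implication are single elements: x -> y = x' when x is orthogonal to y, because then
  L(x',y') has the greatest element (x v y)', and x -> y = y v x' when y <= x. These two
  formulas evaluate every nested implication in the axioms. Finite height is needed only to put a
  maximal element above each element of L(x',y'), which gives nonemptiness and (O5), and for the
  absence of infinite ascending sequences.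
*)
theory Submission
  imports Defs
begin

section \<open>Orthogonal joins, bounds and maximal elements\<close>

context orthomodular_poset
begin

text \<open>The join is a Hilbert choice; orthogonality supplies a least upper bound, so the chosen
  element is a genuine one.\<close>

lemma join_least:
  assumes "x \<in> carrier P" "y \<in> carrier P" "x \<sqsubseteq> neg y"
  shows "least P (x \<squnion> y) (Upper P {x, y})"
  using orthogonal_join_exists[OF assms] unfolding join_def sup_def by (rule someI_ex)

lemma orthogonal_sym:
  assumes "x \<in> carrier P" "y \<in> carrier P" "x \<sqsubseteq> neg y"
  shows "y \<sqsubseteq> neg x"
  using neg_antitone[OF assms(1) neg_closed[OF assms(2)] assms(3)] assms neg_involution by simp

lemma le_iff_neg_le:
  assumes "x \<in> carrier P" "y \<in> carrier P"
  shows "x \<sqsubseteq> y \<longleftrightarrow> neg y \<sqsubseteq> neg x"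
  using assms neg_antitone neg_closed neg_involution by metis

lemma orthogonal_join:
  assumes "x \<in> carrier P" "y \<in> carrier P" "x \<sqsubseteq> neg y"
  shows orthogonal_join_closed: "x \<squnion> y \<in> carrier P"
    and orthogonal_join_upper1: "x \<sqsubseteq> x \<squnion> y"
    and orthogonal_join_upper2: "y \<sqsubseteq> x \<squnion> y"
  using join_least[OF assms] assms by (auto simp: least_def Upper_def)

lemma orthogonal_join_le:
  assumes "x \<in> carrier P" "y \<in> carrier P" "x \<sqsubseteq> neg y" "z \<in> carrier P" "x \<sqsubseteq> z" "y \<sqsubseteq> z"
  shows "x \<squnion> y \<sqsubseteq> z"
  using join_least[OF assms(1-3)] assms by (auto simp: least_def Upper_def)

lemma bottom_join:
  assumes "x \<in> carrier P"
  shows "\<bottom> \<squnion> x = x"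
  using assms orthogonal_join[of \<bottom> x] orthogonal_join_le[of \<bottom> x x]
    bottom_closed bottom_lower neg_closed le_refl le_antisym by metis

text \<open>The join \<open>\<bottom> \<squnion> neg \<bottom>\<close> evaluates to
  \<open>neg \<bottom>\<close> by \<open>bottom_join\<close> and to \<open>\<top>\<close> by
  \<open>join_neg\<close>.\<close>

lemma neg_bottom: "neg \<bottom> = \<top>"
  using bottom_join[of "neg \<bottom>"] join_neg[of \<bottom>] neg_closed by simp

lemma neg_top: "neg \<top> = \<bottom>"
  using neg_bottom neg_involution[of \<bottom>] by simp

text \<open>Makes the implication single-valued wherever the common lower bounds have a greatest
  element.\<close>

lemma maximal_elements_eq_greatest:
  assumes "greatest P m A"
  shows "maximal_elements P A = {m}"
proof -
  note m = greatest_closed[OF assms] greatest_mem[OF assms] greatest_le[OF assms]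
  have "a = m" if "a \<in> A" "m \<sqsubseteq> a" for a
    using that m assms by (intro le_antisym) (auto simp: greatest_def)
  then show ?thesis
    using m by (auto simp: maximal_elements_def)
qed

lemma maximal_lower_absorb:
  assumes "a \<in> carrier P" "b \<in> carrier P" "b \<sqsubseteq> a"
  shows "maximal_elements P (Lower P {a, b}) = {b}"
  using assms by (intro maximal_elements_eq_greatest) (auto simp: greatest_def Lower_def)

section \<open>Values of the implication and its relation to the order\<close>

lemma imp_eq_top_of_le:
  assumes "x \<in> carrier P" "y \<in> carrier P" "x \<sqsubseteq> y"
  shows "orthomodular_imp P neg x y = {\<top>}"
  \<comment> \<open>Here \<open>neg y\<close> is the greatest common lower bound, so the only value
    is \<open>y \<squnion> neg y\<close>.\<close>
  using maximal_lower_absorb[of "neg x" "neg y"] assms neg_closed neg_antitone join_neg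
  by (simp add: orthomodular_imp_def)

lemma imp_of_ge:
  assumes "x \<in> carrier P" "y \<in> carrier P" "y \<sqsubseteq> x"
  shows "orthomodular_imp P neg x y = {y \<squnion> neg x}"
  using maximal_lower_absorb[of "neg y" "neg x"] assms neg_closed neg_antitone
  by (simp add: orthomodular_imp_def insert_commute)

lemma imp_of_orthogonal:
  assumes x: "x \<in> carrier P" and y: "y \<in> carrier P" and xy: "x \<sqsubseteq> neg y"
  shows "orthomodular_imp P neg x y = {neg x}"
proof -
  let ?m = "neg (x \<squnion> y)"
  note j = orthogonal_join[OF x y xy]
  have "?m \<in> carrier P" "?m \<sqsubseteq> neg x" "?m \<sqsubseteq> neg y"
    using j x y neg_closed neg_antitone by auto
  then have m: "?m \<in> Lower P {neg x, neg y}"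
    using x y neg_closed by (auto simp: Lower_def)
  \<comment> \<open>De Morgan: \<open>neg t\<close> is an upper bound of \<open>x\<close> and
    \<open>y\<close>, hence above their join.\<close>
  have "t \<in> carrier P \<and> t \<sqsubseteq> ?m" if "t \<in> Lower P {neg x, neg y}" for t
  proof -
    have t: "t \<in> carrier P" "t \<sqsubseteq> neg x" "t \<sqsubseteq> neg y"
      using that x y neg_closed by (auto simp: Lower_def)
    then have "x \<sqsubseteq> neg t" "y \<sqsubseteq> neg t"
      using orthogonal_sym x y by auto
    then have "x \<squnion> y \<sqsubseteq> neg t"
      using orthogonal_join_le x y xy t neg_closed by meson
    then show ?thesis
      using orthogonal_sym j t by meson
  qed
  with m have "greatest P ?m (Lower P {neg x, neg y})"
    unfolding greatest_def by auto
  then have "maximal_elements P (Lower P {neg x, neg y}) = {?m}"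
    by (rule maximal_elements_eq_greatest)
  \<comment> \<open>This is the orthomodular law for \<open>y \<sqsubseteq> neg x\<close>, with
    \<open>neg (neg x)\<close> simplified to \<open>x\<close>.\<close>
  moreover have "?m \<squnion> y = neg x"
    using orthomodular[of y "neg x"] orthogonal_sym[OF x y xy] x y neg_closed neg_involution
    by simp
  ultimately show ?thesis
    by (simp add: orthomodular_imp_def join_comm)
qed

lemma imp_bottom:
  assumes "x \<in> carrier P"
  shows "orthomodular_imp P neg x \<bottom> = {neg x}"
  using imp_of_orthogonal[of x \<bottom>] assms bottom_closed top_higher neg_bottom by simp

lemma maximal_lowerD:
  assumes "t \<in> maximal_elements P (Lower P {a, b})" "a \<in> carrier P" "b \<in> carrier P"
  shows "t \<in> carrier P" "t \<sqsubseteq> a" "t \<sqsubseteq> b"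
  using assms by (auto simp: maximal_elements_def Lower_def)

text \<open>The orthomodular law for \<open>t \<sqsubseteq> neg y\<close> gives
  \<open>neg (y \<squnion> t) \<squnion> t = neg y\<close>, and its left side is
  \<open>\<bottom> \<squnion> t = t\<close>.\<close>

lemma eq_neg_of_join_eq_top:
  assumes t: "t \<in> carrier P" and y: "y \<in> carrier P" and ty: "t \<sqsubseteq> neg y" and eq: "y \<squnion> t = \<top>"
  shows "t = neg y"
  using orthomodular[of t "neg y"] assms neg_closed neg_involution neg_top bottom_join by simp

text \<open>The last property, \<open>y \<sqsubseteq> neg t\<close>, is the orthogonality under
  which \<open>y \<squnion> t\<close> is a genuine join.\<close>

lemma imp_memE:
  assumes "c \<in> orthomodular_imp P neg x y" "x \<in> carrier P" "y \<in> carrier P"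
  obtains t where "c = y \<squnion> t" "t \<in> maximal_elements P (Lower P {neg x, neg y})"
    "t \<in> carrier P" "t \<sqsubseteq> neg x" "t \<sqsubseteq> neg y" "y \<sqsubseteq> neg t"
proof -
  obtain t where c: "c = y \<squnion> t" and t: "t \<in> maximal_elements P (Lower P {neg x, neg y})"
    using assms(1) by (auto simp: orthomodular_imp_def)
  show thesis
    using that[OF c t] maximal_lowerD[OF t] orthogonal_sym assms neg_closed by meson
qed

lemma imp_eq_top_iff:
  assumes x: "x \<in> carrier P" and y: "y \<in> carrier P"
  shows "orthomodular_imp P neg x y = {\<top>} \<longleftrightarrow> x \<sqsubseteq> y"
proof
  assume "orthomodular_imp P neg x y = {\<top>}"
  then have "\<top> \<in> orthomodular_imp P neg x y" by simp
  then obtain t where t: "\<top> = y \<squnion> t" "t \<in> carrier P" "t \<sqsubseteq> neg x" "t \<sqsubseteq> neg y"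
    using x y by (rule imp_memE)
  then have "t = neg y"
    using eq_neg_of_join_eq_top y by simp
  then show "x \<sqsubseteq> y"
    using t le_iff_neg_le x y by simp
qed (rule imp_eq_top_of_le[OF x y])

lemma imp_closed:
  assumes "x \<in> carrier P" "y \<in> carrier P"
  shows "orthomodular_imp P neg x y \<subseteq> carrier P"
  using imp_memE[OF _ assms] orthogonal_join_closed assms by (metis subsetI)

lemma le_of_mem_imp:
  assumes "x \<in> carrier P" "y \<in> carrier P" "c \<in> orthomodular_imp P neg x y"
  shows "y \<sqsubseteq> c"
  using imp_memE[OF assms(3,1,2)] orthogonal_join_upper1 assms by metis

end

section \<open>Consequences of finite height\<close>

context finite_height_orthomodular_poset
begin

text \<open>Zorn's lemma on the part of \<open>A\<close> above \<open>a\<close>: chains there are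
  finite and therefore bounded.\<close>

lemma maximal_element_above:
  assumes A: "A \<subseteq> carrier P" and a: "a \<in> A"
  obtains m where "m \<in> maximal_elements P A" "a \<sqsubseteq> m"
proof -
  let ?B = "{b \<in> A. a \<sqsubseteq> b}"
  have po: "partial_order_on ?B (relation_of (\<sqsubseteq>) ?B)"
  proof (rule partial_order_on_relation_ofI)
    show "b \<sqsubseteq> b" if "b \<in> ?B" for b
      using that A by auto
    show "b \<sqsubseteq> d" if "b \<in> ?B" "c \<in> ?B" "d \<in> ?B" "b \<sqsubseteq> c" "c \<sqsubseteq> d" for b c d
      using that A le_trans[of b c d] by auto
    show "b = c" if "b \<in> ?B" "c \<in> ?B" "b \<sqsubseteq> c" "c \<sqsubseteq> b" for b c
      using that A le_antisym[of b c] by auto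
  qed
  have "\<exists>m\<in>?B. \<forall>b\<in>?B. m \<sqsubseteq> b \<longrightarrow> b = m"
  proof (rule predicate_Zorn[OF po])
    fix C assume C: "C \<in> Chains (relation_of (\<sqsubseteq>) ?B)"
    then have CB: "C \<subseteq> ?B" and tot: "\<And>b c. b \<in> C \<Longrightarrow> c \<in> C \<Longrightarrow> b \<sqsubseteq> c \<or> c \<sqsubseteq> b"
      unfolding Chains_def relation_of_def by auto
    have "finite C"
      using CB A tot by (intro finite_chains) (auto simp: Complete_Partial_Order.chain_def)
    \<comment> \<open>Allowing \<open>a\<close> itself as the bound covers the empty chain, which
      starts the induction.\<close>
    then have "\<exists>u\<in>insert a C. \<forall>b\<in>C. b \<sqsubseteq> u"
      using CB tot
    proof (induction C)
      case empty
      then show ?case by simp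
    next
      case (insert c C)
      then obtain u where u: "u \<in> insert a C" "\<forall>b\<in>C. b \<sqsubseteq> u" by auto
      show ?case
      proof (cases "c \<sqsubseteq> u")
        case True
        then show ?thesis using u by auto
      next
        case False
        then have "u \<sqsubseteq> c" using u insert.prems(1) insert.prems(2)[of u c] by auto
        moreover have "u \<in> carrier P" "c \<in> carrier P" "C \<subseteq> carrier P"
          using u insert.prems(1) A a by auto
        ultimately have "\<forall>b\<in>insert c C. b \<sqsubseteq> c"
          using u(2) le_trans[of _ u c] le_refl[of c] by auto
        then show ?thesis by auto
      qed
    qed
    moreover have "insert a C \<subseteq> ?B"
      using CB a A by auto
    ultimately show "\<exists>u\<in>?B. \<forall>b\<in>C. b \<sqsubseteq> u"
      by (metis (no_types, lifting) subsetD)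
  qed
  then obtain m where m: "m \<in> A" "a \<sqsubseteq> m" and max: "\<And>b. b \<in> A \<Longrightarrow> a \<sqsubseteq> b \<Longrightarrow> m \<sqsubseteq> b \<Longrightarrow> b = m"
    by auto
  \<comment> \<open>Anything above \<open>m\<close> is above \<open>a\<close>, so maximality in
    \<open>?B\<close> passes to \<open>A\<close>.\<close>
  have "b = m" if "b \<in> A" "m \<sqsubseteq> b" for b
    using max[of b] le_trans[of a m b] that m A a by auto
  then have "m \<in> maximal_elements P A"
    using m by (simp add: maximal_elements_def)
  then show thesis
    using that m by meson
qed

text \<open>\<open>\<bottom>\<close> is a common lower bound, and some maximal one lies above
  it.\<close>

lemma imp_nonempty:
  assumes "x \<in> carrier P" "y \<in> carrier P"
  shows "orthomodular_imp P neg x y \<noteq> {}"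
proof -
  have "\<bottom> \<in> Lower P {neg x, neg y}"
    using assms neg_closed bottom_lower bottom_closed by (auto simp: Lower_def)
  then show ?thesis
    using maximal_element_above[of "Lower P {neg x, neg y}" \<bottom>]
    by (auto simp: orthomodular_imp_def)
qed

text \<open>The order form of (O5). A common lower bound \<open>t\<close> of \<open>neg y\<close>
  and \<open>neg z\<close> is also one of \<open>neg x\<close> and \<open>neg z\<close>; enlarging
  it to a maximal \<open>s\<close> enlarges the join with \<open>z\<close>.\<close>

lemma imp_antitone:
  assumes x: "x \<in> carrier P" and y: "y \<in> carrier P" and z: "z \<in> carrier P" and xy: "x \<sqsubseteq> y"
    and c: "c \<in> orthomodular_imp P neg y z"
  shows "\<exists>d\<in>orthomodular_imp P neg x z. c \<sqsubseteq> d"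
proof -
  obtain t where t: "c = z \<squnion> t" "t \<in> carrier P" "t \<sqsubseteq> neg y" "t \<sqsubseteq> neg z" "z \<sqsubseteq> neg t"
    using c y z by (rule imp_memE)
  have "t \<sqsubseteq> neg x"
    using t neg_antitone[OF x y xy] le_trans x y neg_closed by meson
  then have "t \<in> Lower P {neg x, neg z}"
    using t x z neg_closed by (auto simp: Lower_def)
  then obtain s where s: "s \<in> maximal_elements P (Lower P {neg x, neg z})" "t \<sqsubseteq> s"
    by (rule maximal_element_above[OF Lower_closed])
  note s' = maximal_lowerD[OF s(1) neg_closed[OF x] neg_closed[OF z]]
  have zs: "z \<sqsubseteq> neg s"
    using orthogonal_sym s' z by meson
  note j = orthogonal_join[OF z s'(1) zs]
  have "t \<sqsubseteq> z \<squnion> s"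
    using le_trans[OF s(2) j(3)] t s' j by meson
  then have "c \<sqsubseteq> z \<squnion> s"
    using orthogonal_join_le t z j by simp
  then show ?thesis
    using s by (auto simp: orthomodular_imp_def)
qed

section \<open>The implication structure of the poset\<close>

sublocale implication: implication_structure "carrier P" "orthomodular_imp P neg" \<bottom> .

lemma one_eq: "implication.one = {\<top>}"
  using imp_eq_top_of_le[of \<bottom> \<bottom>] bottom_closed
  by (simp add: implication.one_def implication.ortho_def implication.set_imp_def)

lemma ortho_singleton: "x \<in> carrier P \<Longrightarrow> implication.ortho {x} = {neg x}"
  using imp_bottom by (simp add: implication.ortho_def implication.set_imp_def)

lemma set_imp_singletons: "implication.set_imp {x} {y} = orthomodular_imp P neg x y"
  by (simp add: implication.set_imp_def)

lemma imp_is_one_iff: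
  assumes "A \<subseteq> carrier P" "B \<subseteq> carrier P"
  shows "implication.imp_is_one A B \<longleftrightarrow> (\<forall>a\<in>A. \<exists>b\<in>B. a \<sqsubseteq> b)"
  using assms imp_eq_top_iff unfolding implication.imp_is_one_def one_eq
  by (meson subsetD)

text \<open>The inner implication is \<open>neg x\<close>, which lies above \<open>y\<close>, so
  \<open>imp_of_ge\<close> returns the join. Thus (O7) and (O8) speak about orthogonal
  joins.\<close>

lemma iterated_imp_of_orthogonal:
  assumes "x \<in> carrier P" "y \<in> carrier P" "x \<sqsubseteq> neg y"
  shows "implication.set_imp (orthomodular_imp P neg x y) {y} = {x \<squnion> y}"
  using assms imp_of_orthogonal[of x y] imp_of_ge[of "neg x" y] orthogonal_sym[of x y]
  by (simp add: set_imp_singletons neg_closed neg_involution join_comm)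

text \<open>(O6) encodes the orthomodular law. With \<open>b = x \<squnion> neg y\<close>, the
  nested terms evaluate from the inside to \<open>y\<close>, \<open>b\<close>, \<open>neg b\<close>,
  \<open>b\<close> and finally \<open>x \<squnion> neg b = y\<close>.\<close>

lemma iterated_imp_of_le:
  assumes x: "x \<in> carrier P" and y: "y \<in> carrier P" and xy: "x \<sqsubseteq> y"
  shows "implication.set_imp
    (implication.set_imp
      (implication.ortho
        (implication.set_imp (implication.set_imp (implication.ortho {y}) {x}) {x})) {x}) {x} = {y}"
proof -
  let ?b = "x \<squnion> neg y"
  have o: "x \<sqsubseteq> neg (neg y)"
    using xy y neg_involution by simp
  note j = orthogonal_join[OF x neg_closed[OF y] o]
  have "implication.set_imp (implication.ortho {y}) {x} = {y}"
    using x y imp_of_orthogonal[of "neg y" x] neg_antitone[OF x y xy]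
    by (simp add: ortho_singleton set_imp_singletons neg_closed neg_involution)
  moreover have "implication.set_imp {y} {x} = {?b}"
    using imp_of_ge[OF y x xy] by (simp add: set_imp_singletons)
  moreover have "implication.ortho {?b} = {neg ?b}"
    using ortho_singleton j by simp
  moreover have "implication.set_imp {neg ?b} {x} = {?b}"
    using imp_of_orthogonal[of "neg ?b" x] neg_antitone[of x ?b] j x
    by (simp add: set_imp_singletons neg_closed neg_involution)
  moreover have "implication.set_imp {?b} {x} = {y}"
    using imp_of_ge[of ?b x] j x orthomodular[OF x y xy]
    by (simp add: set_imp_singletons join_comm)
  ultimately show ?thesis
    by simp
qed

text \<open>By transitivity the sequence is monotone, so its range is a chain and finite, against
  injectivity.\<close>

lemma no_infinite_ascending_sequence:
  assumes "range a \<subseteq> carrier P" "inj a" "\<And>n::nat. a n \<sqsubseteq> a (Suc n)"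
  shows False
proof -
  have mono: "a m \<sqsubseteq> a n" if "m \<le> n" for m n
    using that
  proof (induction rule: dec_induct)
    case base
    have "a m \<in> carrier P" using assms(1) by auto
    then show ?case by (rule le_refl)
  next
    case (step k)
    then show ?case using assms le_trans by (meson range_subsetD)
  qed
  have "Complete_Partial_Order.chain (\<sqsubseteq>) (range a)"
    using mono by (auto simp: Complete_Partial_Order.chain_def) (meson linear)
  then have "finite (range a)"
    using finite_chains assms(1) by meson
  then show False
    using assms(2) finite_imageD infinite_UNIV_nat by meson
qed

end

theorem theorem2p5:
  fixes P :: "('a, 'b) gorder_scheme" and neg :: "'a \<Rightarrow> 'a"
  assumes "finite_height_orthomodular_poset P neg"
  shows "finite_height_implication_orthomodular_poset
           (carrier P) (orthomodular_imp P neg) \<bottom>\<^bsub>P\<^esub>"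
proof -
  interpret finite_height_orthomodular_poset P neg by (rule assms)
  show ?thesis
  \<comment> \<open>Replacing \<open>one\<close> by the singleton of the top puts the goals in the
    form that \<open>imp_eq_top_iff\<close> turns into order statements.\<close>
  proof (unfold_locales, unfold one_eq)
    show "\<bottom>\<^bsub>P\<^esub> \<in> carrier P"
      by (rule bottom_closed)
  next
    fix x y assume xy: "x \<in> carrier P" "y \<in> carrier P"
    show "orthomodular_imp P neg x y \<subseteq> carrier P" "orthomodular_imp P neg x y \<noteq> {}"
      using xy by (rule imp_closed, rule imp_nonempty)
    \<comment> \<open>(O10): every value of the implication from \<open>y\<close> to
      \<open>x\<close> is above \<open>x\<close>, and there is at least one.\<close>
    show "implication.imp_is_one {x} (orthomodular_imp P neg y x)"
      using xy imp_is_one_iff imp_closed imp_nonempty le_of_mem_imp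
      by (metis (no_types, lifting) empty_subsetI ex_in_conv insert_subset singletonD)
  next
    fix x assume x: "x \<in> carrier P"
    show "orthomodular_imp P neg \<bottom>\<^bsub>P\<^esub> x = {\<top>\<^bsub>P\<^esub>} \<and> orthomodular_imp P neg x x = {\<top>\<^bsub>P\<^esub>}"
      using x imp_eq_top_iff bottom_closed bottom_lower le_refl by simp
    show "implication.ortho (implication.ortho {x}) = {x}"
      using x by (simp add: ortho_singleton neg_closed neg_involution)
    \<comment> \<open>(O9): \<open>neg x\<close> is orthogonal to \<open>x\<close>, so the left set
      is \<open>{x}\<close> and reflexivity remains.\<close>
    show "implication.imp_is_one (implication.set_imp (implication.ortho {x}) {x}) {x}"
      using x imp_of_orthogonal[of "neg x" x]
      by (simp add: ortho_singleton set_imp_singletons imp_is_one_iff neg_closed neg_involution)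
  next
    fix x y assume "x \<in> carrier P" "y \<in> carrier P"
      "orthomodular_imp P neg x y = {\<top>\<^bsub>P\<^esub>}" "orthomodular_imp P neg y x = {\<top>\<^bsub>P\<^esub>}"
    then show "x = y"
      using imp_eq_top_iff le_antisym by simp
  next
    fix x y z assume "x \<in> carrier P" "y \<in> carrier P" "z \<in> carrier P"
      "orthomodular_imp P neg x y = {\<top>\<^bsub>P\<^esub>}" "orthomodular_imp P neg y z = {\<top>\<^bsub>P\<^esub>}"
    then show "orthomodular_imp P neg x z = {\<top>\<^bsub>P\<^esub>}"
      using imp_eq_top_iff le_trans by meson
  next
    fix x y z assume "x \<in> carrier P" "y \<in> carrier P" "z \<in> carrier P"
      "orthomodular_imp P neg x y = {\<top>\<^bsub>P\<^esub>}"
    then show "implication.imp_is_one (orthomodular_imp P neg y z) (orthomodular_imp P neg x z)"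
      using imp_eq_top_iff imp_antitone imp_closed by (subst imp_is_one_iff) auto
  next
    fix x y assume "x \<in> carrier P" "y \<in> carrier P" "orthomodular_imp P neg x y = {\<top>\<^bsub>P\<^esub>}"
    then show "implication.set_imp
      (implication.set_imp
        (implication.ortho
          (implication.set_imp (implication.set_imp (implication.ortho {y}) {x}) {x})) {x}) {x} = {y}"
      using iterated_imp_of_le imp_eq_top_iff by meson
  next
    fix x y assume xy: "x \<in> carrier P" "y \<in> carrier P"
      "implication.imp_is_one {x} (implication.ortho {y})"
    then have "x \<sqsubseteq>\<^bsub>P\<^esub> neg y"
      by (simp add: ortho_singleton imp_is_one_iff neg_closed)
    \<comment> \<open>(O7) says that the orthogonal join is an upper bound.\<close>
    then show "implication.imp_is_one {x} (implication.set_imp (orthomodular_imp P neg x y) {y}) \<and>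
      implication.imp_is_one {y} (implication.set_imp (orthomodular_imp P neg x y) {y})"
      using xy orthogonal_join[of x y] by (simp add: iterated_imp_of_orthogonal imp_is_one_iff)
  next
    fix x y z assume xyz: "x \<in> carrier P" "y \<in> carrier P" "z \<in> carrier P"
      "implication.imp_is_one {x} (implication.ortho {y})"
      "orthomodular_imp P neg x z = {\<top>\<^bsub>P\<^esub>}" "orthomodular_imp P neg y z = {\<top>\<^bsub>P\<^esub>}"
    then have "x \<sqsubseteq>\<^bsub>P\<^esub> neg y"
      by (simp add: ortho_singleton imp_is_one_iff neg_closed)
    \<comment> \<open>(O8) says that the orthogonal join is below every upper bound.\<close>
    then show "implication.imp_is_one
      (implication.set_imp (orthomodular_imp P neg x y) {y}) {z}"
      using xyz orthogonal_join_closed[of x y] orthogonal_join_le[of x y z] imp_eq_top_iff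
      by (simp add: iterated_imp_of_orthogonal imp_is_one_iff)
  next
    show "\<nexists>a :: nat \<Rightarrow> 'a. range a \<subseteq> carrier P \<and> inj a \<and>
      (\<forall>n. orthomodular_imp P neg (a n) (a (Suc n)) = {\<top>\<^bsub>P\<^esub>})"
      using no_infinite_ascending_sequence imp_eq_top_iff by (metis range_subsetD)
  qed
qed

end
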